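(* For every integer $k\ge 3$ there are infinitely many (pairwise non-isomorphic) finite $2$-regular, asymmetric $k$-graphs.
   Context: For $k\ge 2$, a $k$-graph ($k$-uniform hypergraph) is a pair $\mathcal{G}=(\mathcal{V}(\mathcal{G}),\mathcal{E}(\mathcal{G}))$ where the edge set $\mathcal{E}(\mathcal{G})$ is a set of $k$-element subsets of the finite vertex set $\mathcal{V}(\mathcal{G})$. An automorphism on a $k$-graph $\mathcal{G}=(\mathcal{V},\mathcal{E})$ is a bijection $\phi\colon\mathcal{V}\to\mathcal{V}$ such that for every $E\in\mathcal{E}$, $\{\phi(v): v\in E\}\in\mathcal{E}$. $\mathcal{G}$ is asymmetric if the identity is the only automorphism on $\mathcal{G}$. The degree of a vertex is the number of edges containing it. A $k$-graph is $r$-regular if every vertex has degree $r$. *)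

theory Defs
  imports Main
begin

type_synonym 'a hypergraph = "'a set \<times> 'a set set"

abbreviation verts :: "'a hypergraph \<Rightarrow> 'a set" where
  "verts G \<equiv> fst G"

abbreviation edges :: "'a hypergraph \<Rightarrow> 'a set set" where
  "edges G \<equiv> snd G"

definition k_graph :: "nat \<Rightarrow> 'a hypergraph \<Rightarrow> bool" where
  "k_graph k G \<longleftrightarrow> finite (verts G) \<and> (\<forall>e\<in>edges G. e \<subseteq> verts G \<and> card e = k)"

definition degree :: "'a hypergraph \<Rightarrow> 'a \<Rightarrow> nat" where
  "degree G v = card {e \<in> edges G. v \<in> e}"

definition regular :: "nat \<Rightarrow> 'a hypergraph \<Rightarrow> bool" where
  "regular r G \<longleftrightarrow> (\<forall>v\<in>verts G. degree G v = r)"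

(* Maps are total functions on the type; only their values on the vertex set matter.
   Hence "is the identity" below means "agrees with the identity on the vertices". *)
definition automorphism :: "'a hypergraph \<Rightarrow> ('a \<Rightarrow> 'a) \<Rightarrow> bool" where
  "automorphism G \<phi> \<longleftrightarrow> bij_betw \<phi> (verts G) (verts G) \<and> (\<forall>e\<in>edges G. \<phi> ` e \<in> edges G)"

definition asymmetric :: "'a hypergraph \<Rightarrow> bool" where
  "asymmetric G \<longleftrightarrow> (\<forall>\<phi>. automorphism G \<phi> \<longrightarrow> (\<forall>v\<in>verts G. \<phi> v = v))"

definition isomorphic :: "'a hypergraph \<Rightarrow> 'b hypergraph \<Rightarrow> bool" where
  "isomorphic G H \<longleftrightarrow>
     (\<exists>\<phi>. bij_betw \<phi> (verts G) (verts H) \<and>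
          (\<forall>e. e \<subseteq> verts G \<longrightarrow> (e \<in> edges G \<longleftrightarrow> \<phi> ` e \<in> edges H)))"

end

(* The dual of a simple k-regular graph (edges become vertices, and the k edges at a vertex form a
   hyperedge) is a 2-regular k-graph, and it inherits asymmetry. So it suffices to find asymmetric
   k-regular graphs of unbounded order. The flag graph of an asymmetric k-regular graph (every vertex
   is blown up to a k-clique) is again asymmetric and k-regular and has k times as many vertices;
   hence one asymmetric k-regular graph is enough. For k = 3 this is the Frucht graph. For k = 4 it
   is a perturbed square of a cycle, which exists on any n >= 10 vertices; for k >= 5 it is the
   complement of the latter on n = k + 5 vertices. *)

theory Submission
  imports Defs
begin

section \<open>Automorphisms, degrees and relabelling\<close>

lemma k_graph_finite_edges:
  assumes "k_graph k G"
  shows "finite (edges G)"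
proof (rule finite_subset)
  show "edges G \<subseteq> Pow (verts G)" using assms by (auto simp: k_graph_def)
  show "finite (Pow (verts G))" using assms by (simp add: k_graph_def)
qed

text \<open>The definition of an automorphism only sends edges to edges. On the finite edge set this
  induced map is injective, hence onto, so non-edges go to non-edges as well.\<close>

lemma automorphism_edge_iff:
  assumes G: "k_graph k G" and \<phi>: "automorphism G \<phi>" and e: "e \<subseteq> verts G"
  shows "\<phi> ` e \<in> edges G \<longleftrightarrow> e \<in> edges G"
proof
  assume img: "\<phi> ` e \<in> edges G"
  have inj: "inj_on \<phi> (verts G)" using \<phi> by (simp add: automorphism_def bij_betw_def)
  have sub: "edges G \<subseteq> Pow (verts G)" using G by (auto simp: k_graph_def)
  have "inj_on ((`) \<phi>) (edges G)"
    using inj_on_image_Pow[OF inj] sub by (rule inj_on_subset)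
  moreover have "(`) \<phi> ` edges G \<subseteq> edges G" using \<phi> by (auto simp: automorphism_def)
  ultimately have "(`) \<phi> ` edges G = edges G"
    using k_graph_finite_edges[OF G] by (intro endo_inj_surj)
  then obtain e' where "e' \<in> edges G" "\<phi> ` e = \<phi> ` e'" using img by (metis imageE)
  with inj e sub show "e \<in> edges G" by (metis PowD inj_on_image_eq_iff subsetD)
qed (use \<phi> in \<open>simp add: automorphism_def\<close>)

lemma degree_eq_card_neighbours:
  assumes "k_graph 2 G"
  shows "degree G v = card {w. {v, w} \<in> edges G}"
proof -
  have "\<exists>w. e = {v, w}" if "e \<in> edges G" "v \<in> e" for e
    using assms that by (auto simp: k_graph_def card_2_iff dest!: bspec[where x = e])
  then have "{e \<in> edges G. v \<in> e} = (\<lambda>w. {v, w}) ` {w. {v, w} \<in> edges G}" by blast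
  moreover have "inj_on (\<lambda>w. {v, w}) {w. {v, w} \<in> edges G}"
    by (auto intro!: inj_onI simp: doubleton_eq_iff)
  ultimately show ?thesis by (simp add: degree_def card_image)
qed

definition asymmetric_regular :: "nat \<Rightarrow> nat \<Rightarrow> 'a hypergraph \<Rightarrow> bool" where
  "asymmetric_regular k r G \<longleftrightarrow> k_graph k G \<and> regular r G \<and> asymmetric G"

text \<open>Conjugation by \<open>f\<close> turns an automorphism of the copy into one of
  \<open>G\<close>. Duals and flag graphs live on new vertex types; relabelling brings them back to
  natural numbers.\<close>

lemma asymmetric_regular_image:
  assumes f: "inj_on f (verts G)" and G: "asymmetric_regular k r G"
  shows "asymmetric_regular k r (f ` verts G, (`) f ` edges G)"
    (is "asymmetric_regular k r ?H")
proof -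
  have kG: "k_graph k G" using G by (simp add: asymmetric_regular_def)
  have sub: "\<And>e. e \<in> edges G \<Longrightarrow> e \<subseteq> verts G" using kG by (auto simp: k_graph_def)
  have "k_graph k ?H"
    using kG f by (auto simp: k_graph_def card_image inj_on_subset)
  moreover have "degree ?H (f v) = degree G v" if v: "v \<in> verts G" for v
  proof -
    have "f v \<in> f ` e \<longleftrightarrow> v \<in> e" if "e \<in> edges G" for e
      using f v sub[OF that] by (rule inj_on_image_mem_iff)
    then have "{e \<in> edges ?H. f v \<in> e} = (`) f ` {e \<in> edges G. v \<in> e}" by auto
    moreover have "inj_on ((`) f) {e \<in> edges G. v \<in> e}"
      by (rule inj_on_subset[OF inj_on_image_Pow[OF f]]) (use sub in auto)
    ultimately show ?thesis by (simp add: degree_def card_image)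
  qed
  moreover have "asymmetric ?H"
    unfolding asymmetric_def
  proof (intro allI impI ballI)
    fix \<phi> w assume \<phi>: "automorphism ?H \<phi>" and w: "w \<in> verts ?H"
    define g where "g = inv_into (verts G) f"
    have g: "bij_betw g (f ` verts G) (verts G)"
      unfolding g_def by (rule bij_betw_inv_into) (simp add: f bij_betw_def)
    have gf: "g ` f ` e = e" if "e \<subseteq> verts G" for e
      unfolding g_def using f that by (rule inv_into_image_cancel)
    have \<phi>': "bij_betw \<phi> (f ` verts G) (f ` verts G)" using \<phi> by (simp add: automorphism_def)
    have "bij_betw (g \<circ> \<phi> \<circ> f) (verts G) (verts G)"
      using f \<phi>' g by (auto intro!: bij_betw_trans simp: bij_betw_def[of f])
    moreover have "(g \<circ> \<phi> \<circ> f) ` e \<in> edges G" if e: "e \<in> edges G" for e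
    proof -
      have "\<phi> ` f ` e \<in> edges ?H" using \<phi> e by (auto simp: automorphism_def)
      then obtain e' where "e' \<in> edges G" "\<phi> ` f ` e = f ` e'" by auto
      then show ?thesis using gf sub by (metis image_comp)
    qed
    ultimately have "automorphism G (g \<circ> \<phi> \<circ> f)" by (simp add: automorphism_def)
    then have id: "g (\<phi> (f v)) = v" if "v \<in> verts G" for v
      using G that by (auto simp: asymmetric_regular_def asymmetric_def)
    obtain v where v: "v \<in> verts G" "w = f v" using w by auto
    then have "\<phi> w \<in> f ` verts G" using \<phi>' by (auto simp: bij_betw_def)
    then have "f (g (\<phi> w)) = \<phi> w" unfolding g_def by (rule f_inv_into_f)
    then show "\<phi> w = w" using id v by simp
  qed
  ultimately show ?thesis using G by (auto simp: asymmetric_regular_def regular_def)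
qed

lemma asymmetric_regular_nat_copy:
  fixes G :: "'a hypergraph"
  assumes G: "asymmetric_regular k r G"
  obtains H :: "nat hypergraph" where "asymmetric_regular k r H" "card (verts H) = card (verts G)"
proof -
  have "finite (verts G)" using G by (simp add: asymmetric_regular_def k_graph_def)
  then obtain f :: "'a \<Rightarrow> nat" where f: "inj_on f (verts G)"
    using finite_imp_inj_to_nat_seg by metis
  show thesis
    using that asymmetric_regular_image[OF f G] card_image[OF f] by fastforce
qed

section \<open>The dual of a regular graph\<close>

definition dual :: "'a hypergraph \<Rightarrow> 'a set hypergraph" where
  "dual G = (edges G, (\<lambda>v. {e \<in> edges G. v \<in> e}) ` verts G)"

text \<open>Distinct vertices share at most one edge, so stars with at least two edges determine
  their centres. An automorphism of the dual permutes the stars and thereby induces a vertex map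
  \<open>\<psi>\<close> of \<open>G\<close>.\<close>

lemma asymmetric_regular_dual:
  assumes G: "asymmetric_regular 2 k G" and k: "k \<ge> 2"
  shows "asymmetric_regular k 2 (dual G)"
proof -
  define st where "st v = {e \<in> edges G. v \<in> e}" for v
  have dual: "verts (dual G) = edges G" "edges (dual G) = st ` verts G"
    by (simp_all add: dual_def st_def)
  have kG: "k_graph 2 G" using G by (simp add: asymmetric_regular_def)
  have fin: "finite (verts G)" using kG by (simp add: k_graph_def)
  have finE: "finite (edges G)" by (rule k_graph_finite_edges[OF kG])
  have sub: "e \<subseteq> verts G" "card e = 2" if "e \<in> edges G" for e
    using kG that by (auto simp: k_graph_def)
  have cst: "card (st v) = k" if "v \<in> verts G" for v
    using G that by (simp add: asymmetric_regular_def regular_def degree_def st_def)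
  have pair: "e = {u, v}" if "e \<in> st u" "e \<in> st v" "u \<noteq> v" for e u v
    using that sub(2)[of e] by (auto simp: st_def card_2_iff)
  have inj: "inj_on st (verts G)"
  proof (rule inj_onI, rule ccontr)
    fix u v assume uv: "u \<in> verts G" "v \<in> verts G" "st u = st v" "u \<noteq> v"
    then have "st u \<subseteq> {{u, v}}" using pair by blast
    then have "card (st u) \<le> 1" using card_mono[of "{{u, v}}" "st u"] by simp
    with cst[OF uv(1)] k show False by simp
  qed
  have "k_graph k (dual G)"
    using finE cst by (auto simp: k_graph_def dual st_def)
  moreover have "degree (dual G) e = 2" if e: "e \<in> edges G" for e
  proof -
    have "{s \<in> st ` verts G. e \<in> s} = st ` e"
      using e sub[OF e] by (auto simp: st_def)
    then show ?thesis using sub[OF e] inj by (simp add: degree_def dual card_image inj_on_subset)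
  qed
  moreover have "\<phi> e = e" if \<phi>: "automorphism (dual G) \<phi>" and e: "e \<in> edges G" for \<phi> e
  proof -
    have bij: "bij_betw \<phi> (edges G) (edges G)" using \<phi> by (simp add: automorphism_def dual)
    have "\<exists>w. w \<in> verts G \<and> \<phi> ` st v = st w" if "v \<in> verts G" for v
      using \<phi> that by (auto simp: automorphism_def dual)
    then obtain \<psi> where \<psi>: "\<And>v. v \<in> verts G \<Longrightarrow> \<psi> v \<in> verts G \<and> \<phi> ` st v = st (\<psi> v)"
      by metis
    have inj\<psi>: "inj_on \<psi> (verts G)"
    proof (rule inj_onI)
      fix u v assume uv: "u \<in> verts G" "v \<in> verts G" "\<psi> u = \<psi> v"
      then have "\<phi> ` st u = \<phi> ` st v" using \<psi> by metis
      moreover have "st u \<subseteq> edges G" "st v \<subseteq> edges G" by (auto simp: st_def)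
      ultimately have "st u = st v" using bij by (metis bij_betw_def inj_on_image_eq_iff)
      then show "u = v" using inj uv by (auto dest: inj_onD)
    qed
    \<comment> \<open>The edge {u, v} is the only common element of the stars of u and v, so its
      image is the only common element of the image stars.\<close>
    have img: "\<phi> e = \<psi> ` e" if e: "e \<in> edges G" for e
    proof -
      obtain u v where uv: "e = {u, v}" "u \<noteq> v" using sub(2)[OF e] by (auto simp: card_2_iff)
      then have "u \<in> verts G" "v \<in> verts G" using sub(1)[OF e] by auto
      moreover from this have "\<psi> u \<noteq> \<psi> v" using inj\<psi> uv(2) by (auto dest: inj_onD)
      moreover have "e \<in> st u" "e \<in> st v" using e uv by (auto simp: st_def)
      ultimately show ?thesis using \<psi> pair[of "\<phi> e" "\<psi> u" "\<psi> v"] uv(1) by auto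
    qed
    have "\<psi> ` verts G \<subseteq> verts G" using \<psi> by auto
    then have "\<psi> ` verts G = verts G" using endo_inj_surj[OF fin _ inj\<psi>] by simp
    moreover have "\<psi> ` e \<in> edges G" if "e \<in> edges G" for e
      using img[OF that] bij that by (metis bij_betw_apply)
    ultimately have "automorphism G \<psi>" using inj\<psi> by (simp add: automorphism_def bij_betw_def)
    then have "\<And>v. v \<in> verts G \<Longrightarrow> \<psi> v = v"
      using G by (simp add: asymmetric_regular_def asymmetric_def)
    then show ?thesis using img[OF e] sub(1)[OF e] by (simp add: subset_iff)
  qed
  ultimately show ?thesis
    by (simp add: asymmetric_regular_def regular_def asymmetric_def dual)
qed

text \<open>Positive degree puts every vertex into an edge, and an edge covers two vertices. Thus
  duals of ever larger graphs become arbitrarily large.\<close>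

lemma card_verts_le_card_dual:
  assumes G: "asymmetric_regular 2 k G" and k: "k > 0"
  shows "card (verts G) \<le> 2 * card (verts (dual G))"
proof -
  have kG: "k_graph 2 G" using G by (simp add: asymmetric_regular_def)
  have "v \<in> \<Union> (edges G)" if "v \<in> verts G" for v
  proof -
    have "card {e \<in> edges G. v \<in> e} \<noteq> 0"
      using G that k by (simp add: asymmetric_regular_def regular_def degree_def)
    then have "{e \<in> edges G. v \<in> e} \<noteq> {}" by (metis card.empty)
    then show ?thesis by auto
  qed
  then have "verts G = \<Union> (edges G)" using kG by (auto simp: k_graph_def)
  then have "card (verts G) \<le> sum card (edges G)"
    by (simp add: card_Union_le_sum_card)
  also have "\<dots> = 2 * card (edges G)" using kG by (simp add: k_graph_def)
  finally show ?thesis by (simp add: dual_def)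
qed

section \<open>The flag graph: enlarging an asymmetric regular graph\<close>

text \<open>For a 2-graph this is the line graph of its subdivision: a flag is half of an edge, and
  each original edge survives as the link between its two halves.\<close>

definition flag_graph :: "'a hypergraph \<Rightarrow> ('a \<times> 'a set) hypergraph" where
  "flag_graph G =
    (let F = {(v, e). e \<in> edges G \<and> v \<in> e}
     in (F, {{p, q} |p q. p \<in> F \<and> q \<in> F \<and> p \<noteq> q \<and> (fst p = fst q \<or> snd p = snd q)}))"

text \<open>The triangles of the flag graph are exactly the triples of flags at a common vertex, so an
  automorphism maps flags at a common vertex to such flags and descends to the original graph.\<close>

lemma asymmetric_regular_flag_graph:
  assumes G: "asymmetric_regular 2 k G" and k: "k \<ge> 3"
  shows "asymmetric_regular 2 k (flag_graph G)"
    and "card (verts (flag_graph G)) = k * card (verts G)"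
proof -
  define F where "F = {(v, e). e \<in> edges G \<and> v \<in> e}"
  define adj where "adj p q \<longleftrightarrow> p \<in> F \<and> q \<in> F \<and> p \<noteq> q \<and> (fst p = fst q \<or> snd p = snd q)" for p q
  have kG: "k_graph 2 G" using G by (simp add: asymmetric_regular_def)
  have fin: "finite (verts G)" using kG by (simp add: k_graph_def)
  have finE: "finite (edges G)" by (rule k_graph_finite_edges[OF kG])
  have sub: "e \<subseteq> verts G" "card e = 2" if "e \<in> edges G" for e
    using kG that by (auto simp: k_graph_def)
  have pair: "e = {u, v}" if "e \<in> edges G" "u \<in> e" "v \<in> e" "u \<noteq> v" for e u v
    using that sub(2)[of e] by (auto simp: card_2_iff)
  have deg: "card {e \<in> edges G. v \<in> e} = k" if "v \<in> verts G" for v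
    using G that by (simp add: asymmetric_regular_def regular_def degree_def)
  have memF: "p \<in> F \<longleftrightarrow> snd p \<in> edges G \<and> fst p \<in> snd p" for p by (auto simp: F_def)
  have FS: "F = (SIGMA v:verts G. {e \<in> edges G. v \<in> e})" using sub by (auto simp: F_def)
  have V: "verts (flag_graph G) = F" by (simp add: flag_graph_def F_def)
  have E: "edges (flag_graph G) = {{p, q} |p q. adj p q}"
    by (simp add: flag_graph_def F_def adj_def Let_def)
  have adjE: "{p, q} \<in> edges (flag_graph G) \<longleftrightarrow> adj p q" for p q
    unfolding E mem_Collect_eq by (metis adj_def doubleton_eq_iff)
  have adjD: "p \<in> F" "q \<in> F" "card {p, q} = 2" if "adj p q" for p q
    using that by (auto simp: adj_def simp del: split_paired_all)
  have finF: "finite F" unfolding FS using fin finE by auto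
  show "card (verts (flag_graph G)) = k * card (verts G)"
    unfolding V FS using fin finE deg by (simp add: card_SigmaI)
  have kF: "k_graph 2 (flag_graph G)"
    using finF unfolding k_graph_def V E by (auto dest: adjD)
  have "degree (flag_graph G) p = k" if p: "p \<in> F" for p
  proof -
    obtain u e where ue: "p = (u, e)" "e \<in> edges G" "u \<in> e" using p by (auto simp: F_def)
    then obtain v where v: "e = {u, v}" "v \<noteq> u" using sub(2) by (fastforce simp: card_2_iff)
    have u: "u \<in> verts G" using ue sub by auto
    \<comment> \<open>One neighbour is the other flag on the same edge; the remaining k - 1 are the
      other flags at u.\<close>
    have "{q. {p, q} \<in> edges (flag_graph G)} = insert (v, e) (Pair u ` ({f \<in> edges G. u \<in> f} - {e}))"
      using ue v by (auto simp: adjE adj_def F_def)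
    moreover have "card (Pair u ` ({f \<in> edges G. u \<in> f} - {e})) = k - 1"
      using deg[OF u] ue finE by (simp add: card_image inj_on_def card_Diff_singleton)
    ultimately show ?thesis
      using finE v k by (subst degree_eq_card_neighbours[OF kF]) (auto simp: card_insert_if)
  qed
  then have reg: "regular k (flag_graph G)" by (simp add: regular_def V)
  have "\<phi> p = p" if \<phi>: "automorphism (flag_graph G) \<phi>" and p: "p \<in> F" for \<phi> p
  proof -
    have bij: "bij_betw \<phi> F F" using \<phi> by (simp add: automorphism_def V)
    have \<phi>F: "\<phi> p \<in> F" if "p \<in> F" for p using bij that by (auto simp: bij_betw_def)
    have \<phi>adj: "adj (\<phi> p) (\<phi> q)" if "adj p q" for p q
    proof -
      have "\<phi> ` {p, q} \<in> edges (flag_graph G)" using \<phi> that by (metis automorphism_def adjE)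
      then show ?thesis by (simp add: adjE)
    qed
    \<comment> \<open>If two corners lay at different vertices, all three flags would share one
      edge, which would then contain three vertices.\<close>
    have triangle: "fst p = fst q" if "adj p q" "adj q r" "adj p r" for p q r
    proof (rule ccontr)
      assume ne: "fst p \<noteq> fst q"
      then have s: "snd p = snd q" using that by (simp add: adj_def)
      then have "fst r \<noteq> fst p" "fst r \<noteq> fst q"
        using ne that by (metis adj_def prod_eq_iff)+
      then have s: "snd p = snd q" "snd r = snd q" "fst r \<noteq> fst p" "fst r \<noteq> fst q"
        using s that by (auto simp: adj_def)
      have "{fst p, fst q, fst r} \<subseteq> snd q" "snd q \<in> edges G"
        using that s by (simp_all add: adj_def memF)
      then have "card {fst p, fst q, fst r} \<le> card (snd q)"
        using sub(1) fin by (intro card_mono) (auto intro: finite_subset)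
      also have "\<dots> = 2" using sub(2) \<open>snd q \<in> edges G\<close> by simp
      finally have "card {fst p, fst q, fst r} \<le> 2" .
      with ne s(3,4) show False by (simp add: card_insert_if)
    qed
    have same: "fst (\<phi> p) = fst (\<phi> q)" if pq: "p \<in> F" "q \<in> F" "fst p = fst q" for p q
    proof (cases "p = q")
      case False
      \<comment> \<open>Since k >= 3, there is a third flag at the vertex, which completes p and q
        to a triangle.\<close>
      have "fst p \<in> verts G" using pq sub by (auto simp: memF)
      then have "card {snd p, snd q} < card {e \<in> edges G. fst p \<in> e}"
        using deg k by (simp add: card_insert_if)
      then have "\<not> {e \<in> edges G. fst p \<in> e} \<subseteq> {snd p, snd q}"
        by (meson card_mono finite.intros linorder_not_le)
      then obtain e where "e \<in> edges G" "fst p \<in> e" "e \<noteq> snd p" "e \<noteq> snd q" by auto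
      then have "adj p q" "adj q (fst p, e)" "adj p (fst p, e)"
        using pq False by (cases p; cases q; simp add: adj_def F_def)+
      then show ?thesis by (intro triangle[OF \<phi>adj \<phi>adj \<phi>adj])
    qed simp
    have "\<exists>e. (v, e) \<in> F" if "v \<in> verts G" for v
    proof -
      have "{e \<in> edges G. v \<in> e} \<noteq> {}" using deg[OF that] k by (metis card.empty not_numeral_le_zero)
      then show ?thesis by (auto simp: F_def)
    qed
    \<comment> \<open>\<open>c\<close> picks an arbitrary flag at each vertex; by
      \<open>same\<close>, the induced map \<open>\<psi>\<close> does not depend on the
      choice.\<close>
    then obtain c where c: "\<And>v. v \<in> verts G \<Longrightarrow> (v, c v) \<in> F" by metis
    define \<psi> where "\<psi> v = fst (\<phi> (v, c v))" for v
    have \<psi>: "fst (\<phi> (v, e)) = \<psi> v" if "(v, e) \<in> F" for v e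
      unfolding \<psi>_def using that c by (intro same) (auto simp: FS)
    have surj: "\<psi> ` verts G = verts G"
    proof
      show "\<psi> ` verts G \<subseteq> verts G" using \<phi>F c by (fastforce simp: \<psi>_def FS)
      show "verts G \<subseteq> \<psi> ` verts G"
      proof
        fix v assume "v \<in> verts G"
        then obtain q where "q \<in> F" "\<phi> q = (v, c v)" using c bij by (metis bij_betw_def imageE)
        then have "\<psi> (fst q) = v" "fst q \<in> verts G" using \<psi>[of "fst q" "snd q"] by (auto simp: FS)
        then show "v \<in> \<psi> ` verts G" by blast
      qed
    qed
    then have inj: "inj_on \<psi> (verts G)" using fin by (simp add: eq_card_imp_inj_on)
    have img: "\<phi> (u, e) = (\<psi> u, \<psi> ` e) \<and> \<psi> ` e \<in> edges G" if ue: "(u, e) \<in> F" for u e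
    proof -
      have "e \<in> edges G" "u \<in> e" using ue by (auto simp: F_def)
      then obtain v where v: "e = {u, v}" "v \<noteq> u" using sub(2) by (fastforce simp: card_2_iff)
      have ve: "(v, e) \<in> F" using ue v by (auto simp: F_def)
      have ne: "\<psi> u \<noteq> \<psi> v" using inj v(2) ue ve by (auto simp: FS dest: inj_onD)
      \<comment> \<open>The images of the two flags on e remain adjacent but sit at different
        vertices, so they share an edge, which must join \<open>\<psi> u\<close> to
        \<open>\<psi> v\<close>.\<close>
      have "adj (u, e) (v, e)" using ue ve v by (auto simp: adj_def)
      from \<phi>adj[OF this] have "snd (\<phi> (u, e)) = snd (\<phi> (v, e))"
        using \<psi>[OF ue] \<psi>[OF ve] ne by (auto simp: adj_def)
      moreover have "\<psi> u \<in> snd (\<phi> (u, e))" "\<psi> v \<in> snd (\<phi> (v, e))" "snd (\<phi> (u, e)) \<in> edges G"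
        using \<phi>F[OF ue] \<phi>F[OF ve] \<psi>[OF ue] \<psi>[OF ve] by (auto simp: F_def)
      ultimately have "snd (\<phi> (u, e)) = {\<psi> u, \<psi> v}" "snd (\<phi> (u, e)) \<in> edges G"
        using pair ne by metis+
      then show ?thesis using \<psi>[OF ue] v(1) by (simp add: prod_eq_iff)
    qed
    have "\<psi> ` e \<in> edges G" if e: "e \<in> edges G" for e
    proof -
      have "e \<noteq> {}" using sub(2)[OF e] by auto
      then show ?thesis using img e by (auto simp: F_def)
    qed
    then have "automorphism G \<psi>" using inj surj by (simp add: automorphism_def bij_betw_def)
    then have id: "\<And>v. v \<in> verts G \<Longrightarrow> \<psi> v = v"
      using G by (simp add: asymmetric_regular_def asymmetric_def)
    obtain u e where ue: "p = (u, e)" by (cases p)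
    then have "e \<subseteq> verts G" "u \<in> verts G" using p sub by (auto simp: F_def)
    then have "\<psi> ` e = e" "\<psi> u = u" using id by (auto simp: subset_iff)
    then show ?thesis using img p ue by simp
  qed
  then have "asymmetric (flag_graph G)" by (simp add: asymmetric_def V)
  with kF reg show "asymmetric_regular 2 k (flag_graph G)" by (simp add: asymmetric_regular_def)
qed

section \<open>Complements\<close>

definition complement :: "'a hypergraph \<Rightarrow> 'a hypergraph" where
  "complement G = (verts G, {e. e \<subseteq> verts G \<and> card e = 2} - edges G)"

text \<open>Every automorphism of the complement also preserves its non-edges, hence is an
  automorphism of \<open>G\<close>. Each vertex trades its r neighbours for the others among the
  remaining n - 1 vertices.\<close>

lemma asymmetric_regular_complement:
  assumes G: "asymmetric_regular 2 r G"
  shows "asymmetric_regular 2 (card (verts G) - 1 - r) (complement G)"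
proof -
  have kG: "k_graph 2 G" using G by (simp add: asymmetric_regular_def)
  have fin: "finite (verts G)" using kG by (simp add: k_graph_def)
  have kC: "k_graph 2 (complement G)" using fin by (auto simp: k_graph_def complement_def)
  have "degree (complement G) v = card (verts G) - 1 - r" if v: "v \<in> verts G" for v
  proof -
    have sub: "{w. {v, w} \<in> edges G} \<subseteq> verts G - {v}"
      using kG by (fastforce simp: k_graph_def)
    have "{w. {v, w} \<in> edges (complement G)} = (verts G - {v}) - {w. {v, w} \<in> edges G}"
      using v by (auto simp: complement_def card_insert_if)
    then have "degree (complement G) v = card (verts G - {v}) - card {w. {v, w} \<in> edges G}"
      unfolding degree_eq_card_neighbours[OF kC]
      using sub fin by (simp add: card_Diff_subset finite_subset)
    then show ?thesis
      using G v fin unfolding asymmetric_regular_def regular_def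
      by (simp flip: degree_eq_card_neighbours)
  qed
  moreover have "automorphism G \<phi>" if \<phi>: "automorphism (complement G) \<phi>" for \<phi>
  proof -
    have bij: "bij_betw \<phi> (verts G) (verts G)" using \<phi> by (simp add: automorphism_def complement_def)
    have "\<phi> ` e \<in> edges G" if e: "e \<in> edges G" for e
    proof -
      have e': "e \<subseteq> verts G" "card e = 2" using kG e by (auto simp: k_graph_def)
      then have "card (\<phi> ` e) = 2" "\<phi> ` e \<subseteq> verts G"
        using bij by (auto simp: bij_betw_def card_image inj_on_subset)
      moreover have "\<phi> ` e \<notin> edges (complement G)"
        using automorphism_edge_iff[OF kC \<phi>] e e' by (simp add: complement_def)
      ultimately show ?thesis by (simp add: complement_def)
    qed
    then show ?thesis using bij by (simp add: automorphism_def)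
  qed
  ultimately show ?thesis
    using G kC by (auto simp: asymmetric_regular_def regular_def asymmetric_def complement_def)
qed

section \<open>Rigidity of graphs given by an adjacency relation\<close>

definition nat_graph :: "nat \<Rightarrow> (nat \<Rightarrow> nat \<Rightarrow> bool) \<Rightarrow> nat hypergraph" where
  "nat_graph n A = ({..<n}, {{x, y} |x y. A x y})"

text \<open>Common setting for the rigidity proofs of both base graphs. With adjacency as an
  equivalence, f preserves and reflects common neighbours, hence triangles.\<close>

locale adjacency_automorphism =
  fixes V :: "'a set" and A :: "'a \<Rightarrow> 'a \<Rightarrow> bool" and f :: "'a \<Rightarrow> 'a"
  assumes bij: "bij_betw f V V"
    and vertex: "A x y \<Longrightarrow> x \<in> V \<and> y \<in> V"
    and adj_iff: "x \<in> V \<Longrightarrow> y \<in> V \<Longrightarrow> A (f x) (f y) \<longleftrightarrow> A x y"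
begin

definition common :: "'a \<Rightarrow> 'a \<Rightarrow> bool" where
  "common x y \<longleftrightarrow> (\<exists>z. A x z \<and> A y z)"

lemma common_iff:
  assumes "x \<in> V" "y \<in> V"
  shows "common (f x) (f y) \<longleftrightarrow> common x y"
proof
  assume "common (f x) (f y)"
  then obtain z where z: "A (f x) z" "A (f y) z" by (auto simp: common_def)
  then obtain w where "w \<in> V" "z = f w" using vertex bij by (metis bij_betw_def imageE)
  then show "common x y" using z adj_iff assms by (auto simp: common_def)
next
  assume "common x y"
  then show "common (f x) (f y)" using vertex adj_iff assms unfolding common_def by metis
qed

lemma f_eq_iff: "x \<in> V \<Longrightarrow> y \<in> V \<Longrightarrow> f x = f y \<longleftrightarrow> x = y"
  using bij by (auto simp: bij_betw_def inj_on_eq_iff)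

lemma f_adj: "A x y \<Longrightarrow> A (f x) (f y)"
  using vertex adj_iff by blast

text \<open>f maps neighbours of a fixed vertex injectively to neighbours; if all but one are fixed,
  nothing but itself is left for the last. This spreads fixedness through a graph.\<close>

lemma fixed_last_neighbour:
  assumes fv: "f v = v" and w: "A v w" and N: "\<And>y. A v y \<Longrightarrow> y = w \<or> f y = y"
  shows "f w = w"
proof (rule ccontr)
  assume "f w \<noteq> w"
  moreover have "A v (f w)" using f_adj[OF w] fv by simp
  ultimately show False using N f_eq_iff vertex w by metis
qed

end

lemma asymmetric_regular_nat_graph:
  assumes range: "\<And>x y. A x y \<Longrightarrow> x < n"
    and sym: "\<And>x y. A x y \<Longrightarrow> A y x"
    and irrefl: "\<And>x. \<not> A x x"
    and deg: "\<And>x. x < n \<Longrightarrow> card {y. A x y} = r"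
    and rigid: "\<And>f x. adjacency_automorphism {..<n} A f \<Longrightarrow> x < n \<Longrightarrow> f x = x"
  shows "asymmetric_regular 2 r (nat_graph n A)"
proof -
  have E: "{x, y} \<in> edges (nat_graph n A) \<longleftrightarrow> A x y" for x y
    using sym by (auto simp: nat_graph_def doubleton_eq_iff)
  have "card {x, y} = 2" if "A x y" for x y
    using irrefl that by (metis card_2_iff)
  then have kG: "k_graph 2 (nat_graph n A)"
    using range range[OF sym] by (auto simp: k_graph_def nat_graph_def)
  have "f x = x" if f: "automorphism (nat_graph n A) f" and x: "x < n" for f x
  proof (rule rigid[OF _ x], unfold_locales)
    show "bij_betw f {..<n} {..<n}" using f by (simp add: automorphism_def nat_graph_def)
    show "A x y \<Longrightarrow> x \<in> {..<n} \<and> y \<in> {..<n}" for x y using range sym by auto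
    show "A (f x) (f y) \<longleftrightarrow> A x y" if "x \<in> {..<n}" "y \<in> {..<n}" for x y
      using automorphism_edge_iff[OF kG f, of "{x, y}"] that E by (simp add: nat_graph_def)
  qed
  then show ?thesis
    using kG deg
    by (simp add: asymmetric_regular_def regular_def asymmetric_def degree_eq_card_neighbours E)
      (simp add: nat_graph_def)
qed

section \<open>The asymmetric 4-regular graphs\<close>

text \<open>The square of the cycle on \<open>0, \<dots>, n - 1\<close> with the edges 01, 34, 02, 45 replaced by
  03, 14, 04, 25. This leaves exactly four edges that lie in no triangle, which anchors the rigidity
  proof: the path 3-0-4-6 and the isolated edge from 1 to \<open>n - 1\<close>.\<close>

definition quartic_step :: "nat \<Rightarrow> nat \<Rightarrow> nat \<Rightarrow> bool" where
  "quartic_step n x y \<longleftrightarrow>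
     x = 0 \<and> (y = 3 \<or> y = 4 \<or> y = n - 2 \<or> y = n - 1) \<or>
     x = 1 \<and> (y = 2 \<or> y = 3 \<or> y = 4 \<or> y = n - 1) \<or>
     x = 2 \<and> (y = 3 \<or> y = 4 \<or> y = 5) \<or>
     x = 3 \<and> y = 5 \<or> x = 4 \<and> y = 6 \<or>
     5 \<le> x \<and> x < y \<and> y \<le> x + 2 \<and> y < n"

definition quartic :: "nat \<Rightarrow> nat \<Rightarrow> nat \<Rightarrow> bool" where
  "quartic n x y \<longleftrightarrow> quartic_step n x y \<or> quartic_step n y x"

text \<open>The adjacency table from which degrees and rigidity are read off. The bound on n keeps n
  - 2 and n - 1 beyond the irregular vertices 0, ..., 6.\<close>

lemma quartic_neighbours:
  assumes "n \<ge> 10"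
  shows "quartic n 0 y \<longleftrightarrow> y = 3 \<or> y = 4 \<or> y = n - 2 \<or> y = n - 1"
    and "quartic n 1 y \<longleftrightarrow> y = 2 \<or> y = 3 \<or> y = 4 \<or> y = n - 1"
    and "quartic n 2 y \<longleftrightarrow> y = 1 \<or> y = 3 \<or> y = 4 \<or> y = 5"
    and "quartic n 3 y \<longleftrightarrow> y = 0 \<or> y = 1 \<or> y = 2 \<or> y = 5"
    and "quartic n 4 y \<longleftrightarrow> y = 0 \<or> y = 1 \<or> y = 2 \<or> y = 6"
    and "quartic n 5 y \<longleftrightarrow> y = 2 \<or> y = 3 \<or> y = 6 \<or> y = 7"
    and "quartic n 6 y \<longleftrightarrow> y = 4 \<or> y = 5 \<or> y = 7 \<or> y = 8"
    and "7 \<le> x \<Longrightarrow> x + 2 < n \<Longrightarrow>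
      quartic n x y \<longleftrightarrow> y = x - 2 \<or> y = x - 1 \<or> y = x + 1 \<or> y = x + 2"
    and "quartic n (n - 2) y \<longleftrightarrow> y = 0 \<or> y = n - 4 \<or> y = n - 3 \<or> y = n - 1"
    and "quartic n (n - 1) y \<longleftrightarrow> y = 0 \<or> y = 1 \<or> y = n - 3 \<or> y = n - 2"
  using assms unfolding quartic_def quartic_step_def
  by - (rule iffI; elim disjE conjE; simp?; presburger?)+

lemma card4:
  "a \<noteq> b \<Longrightarrow> a \<noteq> c \<Longrightarrow> a \<noteq> d \<Longrightarrow> b \<noteq> c \<Longrightarrow> b \<noteq> d \<Longrightarrow> c \<noteq> d \<Longrightarrow>
    card {y. y = a \<or> y = b \<or> y = c \<or> y = d} = 4"
proof -
  assume "a \<noteq> b" "a \<noteq> c" "a \<noteq> d" "b \<noteq> c" "b \<noteq> d" "c \<noteq> d"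
  moreover have "{y. y = a \<or> y = b \<or> y = c \<or> y = d} = {a, b, c, d}" by auto
  ultimately show ?thesis by simp
qed

lemma quartic_vertex_cases:
  fixes n x :: nat
  assumes "n \<ge> 10" "x < n"
  obtains "x = 0" | "x = 1" | "x = 2" | "x = 3" | "x = 4" | "x = 5" | "x = 6"
    | "7 \<le> x" "x + 2 < n" | "x = n - 2" | "x = n - 1"
  using assms by linarith

lemma quartic_degree:
  assumes n: "n \<ge> 10" and x: "x < n"
  shows "card {y. quartic n x y} = 4"
  using n x
  by (cases rule: quartic_vertex_cases[OF n x])
    (simp_all only: quartic_neighbours[OF n], (rule card4; linarith)+)

lemma quartic_triangle_free_edge:
  assumes n: "n \<ge> 10" and xy: "quartic n x y"
  shows "(\<exists>z. quartic n x z \<and> quartic n y z) \<longleftrightarrow>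
    {x, y} \<notin> {{0, 3}, {0, 4}, {4, 6}, {1, n - 1}}"
proof -
  have none: "\<not> (quartic n 0 z \<and> quartic n 3 z)" "\<not> (quartic n 0 z \<and> quartic n 4 z)"
    "\<not> (quartic n 4 z \<and> quartic n 6 z)" "\<not> (quartic n 1 z \<and> quartic n (n - 1) z)" for z
    unfolding quartic_neighbours[OF n] using n by linarith+
  have step: "(\<exists>z. quartic n x z \<and> quartic n y z) \<longleftrightarrow>
    \<not> (x = 0 \<and> y = 3 \<or> x = 0 \<and> y = 4 \<or> x = 4 \<and> y = 6 \<or> x = 1 \<and> y = n - 1)"
    (is "?L \<longleftrightarrow> \<not> ?R") if xy: "quartic_step n x y" for x y
  proof
    assume ?L
    then show "\<not> ?R" using none by blast
  next
    assume R: "\<not> ?R"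
    \<comment> \<open>For x >= 5, a step of length two has its middle vertex as common neighbour, a
      step of length one the vertex x + 2, and 0 serves the last edge {n - 2, n - 1}. The other
      cases treat the modified start.\<close>
    define z where "z =
      (if x = 0 then (if y = n - 2 then n - 1 else n - 2)
       else if x = 1 then (if y = 2 then 3 else 2)
       else if x = 2 then (if y = 5 then 3 else 1)
       else if x = 3 then 2
       else if y = x + 2 then x + 1 else if y = n - 1 then 0 else x + 2)"
    have "quartic n x z \<and> quartic n y z"
    proof (cases "5 \<le> x")
      case True
      then have "x < y" "y \<le> x + 2" "y < n" using xy by (auto simp: quartic_step_def)
      with True n show ?thesis
        unfolding z_def quartic_def quartic_step_def by (auto split: if_splits)
    next
      case False
      with xy R n show ?thesis
        unfolding quartic_step_def
        by (elim disjE conjE; (simp add: z_def quartic_def quartic_step_def; presburger?))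
    qed
    then show ?L by blast
  qed
  from xy have "quartic_step n x y \<or> quartic_step n y x" by (simp add: quartic_def)
  then show ?thesis
  proof
    assume s: "quartic_step n x y"
    \<comment> \<open>\<open>quartic_step\<close> lists each edge with its smaller end first, so the
      unordered pair determines the ordered one.\<close>
    then have "x < y" using n by (auto simp: quartic_step_def)
    then show ?thesis unfolding step[OF s] using n by (auto simp: doubleton_eq_iff)
  next
    assume s: "quartic_step n y x"
    then have "y < x" using n by (auto simp: quartic_step_def)
    then show ?thesis unfolding conj_commute[of "quartic n x _"] step[OF s]
      using n by (auto simp: doubleton_eq_iff)
  qed
qed

text \<open>Edges in no triangle go to such edges, which fixes the path 3-0-4-6 up to reversal. Once
  reversal is excluded, fixedness spreads from the path to all vertices.\<close>

lemma quartic_rigid: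
  assumes n: "n \<ge> 10" and f: "adjacency_automorphism {..<n} (quartic n) f" and x: "x < n"
  shows "f x = x"
proof -
  interpret adjacency_automorphism "{..<n}" "quartic n" f by (rule f)
  note N = quartic_neighbours[OF n]
  have inj: "f x = f y \<longleftrightarrow> x = y" if "x < n" "y < n" for x y
    using f_eq_iff that by simp
  define free where "free x y \<longleftrightarrow> quartic n x y \<and> \<not> common x y" for x y
  have free_pair: "free x y \<longleftrightarrow> {x, y} \<in> {{0, 3}, {0, 4}, {4, 6}, {1, n - 1}}" for x y
  proof -
    have "quartic n 0 3" "quartic n 3 0" "quartic n 0 4" "quartic n 4 0" "quartic n 4 6"
      "quartic n 6 4" "quartic n 1 (n - 1)" "quartic n (n - 1) 1"
      unfolding N by simp_all
    then have adj: "quartic n x y" if "{x, y} \<in> {{0, 3}, {0, 4}, {4, 6}, {1, n - 1}}"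
      using that by (auto simp: doubleton_eq_iff)
    show ?thesis
    proof (cases "quartic n x y")
      case True
      then show ?thesis
        unfolding free_def common_def quartic_triangle_free_edge[OF n True] by (simp only: not_not simp_thms)
    next
      case False
      then show ?thesis using adj free_def by metis
    qed
  qed
  then have free_iff: "free x y \<longleftrightarrow> x = 0 \<and> y = 3 \<or> x = 3 \<and> y = 0 \<or> x = 0 \<and> y = 4 \<or>
    x = 4 \<and> y = 0 \<or> x = 4 \<and> y = 6 \<or> x = 6 \<and> y = 4 \<or> x = 1 \<and> y = n - 1 \<or> x = n - 1 \<and> y = 1"
    for x y
    by (auto simp: doubleton_eq_iff)
  have f_free: "free (f x) (f y)" if "free x y" for x y
  proof -
    have "x < n \<and> y < n" using that vertex by (auto simp: free_def)
    then show ?thesis using that f_adj common_iff[of x y] by (auto simp: free_def)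
  qed
  have "free (f 0) (f 3)" "free (f 0) (f 4)" "free (f 4) (f 6)" "f 3 \<noteq> f 4" "f 0 \<noteq> f 6" "f 0 \<noteq> f 4"
    using f_free free_iff inj n by auto
  then have "f 0 = 0 \<and> f 3 = 3 \<and> f 4 = 4 \<and> f 6 = 6 \<or> f 0 = 4 \<and> f 3 = 6 \<and> f 4 = 0 \<and> f 6 = 3"
    unfolding free_iff using n by presburger
  \<comment> \<open>Reversing the path 3-0-4-6 is impossible: 3 and 4 have the common neighbours 1 and 2, whereas
    6 and 0 have at most one common neighbour besides 4 (and one only for \<open>n = 10\<close>).\<close>
  moreover have False if swap: "f 0 = 4" "f 3 = 6" "f 4 = 0"
  proof -
    have "f v = 8" if v: "v = 1 \<or> v = 2" for v
    proof -
      have "quartic n 3 v" "quartic n 4 v" using v by (auto simp: N)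
      then have "quartic n 6 (f v)" "quartic n 0 (f v)" using f_adj swap by metis+
      moreover have "f v \<noteq> 4" using v swap inj[of v 0] n by auto
      ultimately show ?thesis using n unfolding N by auto
    qed
    then show False using inj[of 1 2] n by simp
  qed
  ultimately have f0: "f 0 = 0" "f 3 = 3" "f 4 = 4" "f 6 = 6" by auto
  \<comment> \<open>With 0, 3, 4, 6 already taken, \<open>f 1\<close> is an end of the isolated
    triangle-free edge; adjacency to 3 distinguishes 1 from n - 1.\<close>
  have "free (f 1) (f (n - 1))" by (rule f_free) (simp add: free_iff)
  moreover have "f 1 \<noteq> 0" "f 1 \<noteq> 3" "f 1 \<noteq> 4" "f 1 \<noteq> 6"
    using inj[of 1 0] inj[of 1 3] inj[of 1 4] inj[of 1 6] f0 n by simp_all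
  moreover have "quartic n 3 (f 1)" using f_adj[of 3 1] f0 by (simp add: N)
  ultimately have f1: "f 1 = 1" "f (n - 1) = n - 1"
    using n unfolding free_iff N by linarith+
  have f2: "f 2 = 2"
    by (rule fixed_last_neighbour[of 1]) (use f0 f1 in \<open>auto simp only: N\<close>)
  have f5: "f 5 = 5"
    by (rule fixed_last_neighbour[of 3]) (use f0 f1 f2 in \<open>auto simp only: N\<close>)
  have f7: "f 7 = 7"
    by (rule fixed_last_neighbour[of 5]) (use f0 f2 f5 in \<open>auto simp only: N\<close>)
  have f8: "f 8 = 8"
    by (rule fixed_last_neighbour[of 6]) (use f0 f5 f7 in \<open>auto simp only: N\<close>)
  show ?thesis
    using x
  proof (induction x rule: less_induct)
    case (less x)
    show ?case
    proof (cases "x < 9")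
      case True
      then consider "x = 0" | "x = 1" | "x = 2" | "x = 3" | "x = 4" | "x = 5" | "x = 6" | "x = 7"
        | "x = 8" by linarith
      then show ?thesis by cases (use f0 f1 f2 f5 f7 f8 in simp_all)
    next
      case False
      \<comment> \<open>For x >= 9 the vertex x - 2 >= 7 has a regular neighbourhood, whose largest
        member is x; its other members are fixed by induction.\<close>
      have N': "quartic n (x - 2) y \<longleftrightarrow> y = x - 4 \<or> y = x - 3 \<or> y = x - 1 \<or> y = x" for y
        using False less.prems N(8)[of "x - 2" y] by auto
      show ?thesis
        by (rule fixed_last_neighbour[of "x - 2"]) (use False less in \<open>auto simp: N'\<close>)
    qed
  qed
qed

section \<open>The Frucht graph\<close>

text \<open>The Hamiltonian cycle 0, 1, ..., 11 with the chords 0-7, 1-11, 2-10, 3-5, 4-9 and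
  6-8.\<close>

definition frucht :: "nat \<Rightarrow> nat \<Rightarrow> bool" where
  "frucht x y \<longleftrightarrow> {x, y} \<in> {{0, 1}, {0, 7}, {0, 11}, {1, 2}, {1, 11}, {2, 3}, {2, 10}, {3, 4},
     {3, 5}, {4, 5}, {4, 9}, {5, 6}, {6, 7}, {6, 8}, {7, 8}, {8, 9}, {9, 10}, {10, 11}}"

lemma frucht_neighbours:
  "frucht 0 y \<longleftrightarrow> y = 1 \<or> y = 7 \<or> y = 11"
  "frucht 1 y \<longleftrightarrow> y = 0 \<or> y = 2 \<or> y = 11"
  "frucht 2 y \<longleftrightarrow> y = 1 \<or> y = 3 \<or> y = 10"
  "frucht 3 y \<longleftrightarrow> y = 2 \<or> y = 4 \<or> y = 5"
  "frucht 4 y \<longleftrightarrow> y = 3 \<or> y = 5 \<or> y = 9"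
  "frucht 5 y \<longleftrightarrow> y = 3 \<or> y = 4 \<or> y = 6"
  "frucht 6 y \<longleftrightarrow> y = 5 \<or> y = 7 \<or> y = 8"
  "frucht 7 y \<longleftrightarrow> y = 0 \<or> y = 6 \<or> y = 8"
  "frucht 8 y \<longleftrightarrow> y = 6 \<or> y = 7 \<or> y = 9"
  "frucht 9 y \<longleftrightarrow> y = 4 \<or> y = 8 \<or> y = 10"
  "frucht 10 y \<longleftrightarrow> y = 2 \<or> y = 9 \<or> y = 11"
  "frucht 11 y \<longleftrightarrow> y = 0 \<or> y = 1 \<or> y = 10"
  by (auto simp: frucht_def doubleton_eq_iff)

lemma frucht_vertex_cases:
  fixes x :: nat
  assumes "x < 12"
  obtains "x = 0" | "x = 1" | "x = 2" | "x = 3" | "x = 4" | "x = 5" | "x = 6" | "x = 7" | "x = 8"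
    | "x = 9" | "x = 10" | "x = 11"
proof -
  have "x = 0 \<or> x = 1 \<or> x = 2 \<or> x = 3 \<or> x = 4 \<or> x = 5 \<or> x = 6 \<or> x = 7 \<or> x = 8 \<or>
    x = 9 \<or> x = 10 \<or> x = 11"
    using assms by presburger
  then show thesis using that by blast
qed

lemma frucht_bound: "frucht x y \<Longrightarrow> x < 12"
  by (auto simp: frucht_def doubleton_eq_iff)

lemma card3: "a \<noteq> b \<Longrightarrow> a \<noteq> c \<Longrightarrow> b \<noteq> c \<Longrightarrow> card {y. y = a \<or> y = b \<or> y = c} = 3"
proof -
  assume "a \<noteq> b" "a \<noteq> c" "b \<noteq> c"
  moreover have "{y. y = a \<or> y = b \<or> y = c} = {a, b, c}" by auto
  ultimately show ?thesis by simp
qed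

lemma frucht_degree: "x < 12 \<Longrightarrow> card {y. frucht x y} = 3"
  by (erule frucht_vertex_cases) (simp_all only: frucht_neighbours, (rule card3; simp)+)

lemma frucht_rigid:
  assumes f: "adjacency_automorphism {..<12} frucht f" and x: "x < 12"
  shows "f x = x"
proof -
  interpret adjacency_automorphism "{..<12}" frucht f by (rule f)
  note N = frucht_neighbours
  have inj: "f x = f y \<longleftrightarrow> x = y" if "x < 12" "y < 12" for x y
    using f_eq_iff that by simp
  \<comment> \<open>The vertices in no triangle are 2, 9 and 10, and only 10 is adjacent to two of them.\<close>
  define tri where "tri x \<longleftrightarrow> (\<exists>y. frucht x y \<and> common x y)" for x
  have tri: "x = 2 \<or> x = 9 \<or> x = 10" if "x < 12" "\<not> tri x" for x
  proof -
    have "frucht x y \<Longrightarrow> frucht x z \<Longrightarrow> frucht y z \<Longrightarrow> False" for y z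
      using that(2) by (auto simp: tri_def common_def)
    \<comment> \<open>These pairs complete 0, 1, 3, 4, 5, 6, 7, 8, 11, in this order, to one of the
      triangles 0-1-11, 3-4-5, 6-7-8.\<close>
    note * = this[of 1 11] this[of 0 11] this[of 4 5] this[of 3 5] this[of 3 4] this[of 7 8]
      this[of 6 8] this[of 6 7] this[of 0 1]
    show ?thesis
      using that(1) by (rule frucht_vertex_cases) (use * in \<open>simp_all only: N\<close>, simp_all)
  qed
  \<comment> \<open>The three groups are the neighbourhoods of 2, 9 and 10; each is
    independent.\<close>
  have "\<not> frucht y z" if "(y = 1 \<or> y = 3 \<or> y = 10) \<and> (z = 1 \<or> z = 3 \<or> z = 10) \<or>
    (y = 4 \<or> y = 8 \<or> y = 10) \<and> (z = 4 \<or> z = 8 \<or> z = 10) \<or>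
    (y = 2 \<or> y = 9 \<or> y = 11) \<and> (z = 2 \<or> z = 9 \<or> z = 11)" for y z
    using that by (elim disjE conjE; hypsubst; simp only: N; simp)
  then have not_tri: "\<not> tri 2" "\<not> tri 9" "\<not> tri 10"
    unfolding tri_def common_def N by blast+
  have tri_if: "tri x" if t: "tri (f x)" "x < 12" for x
  proof -
    obtain y where y: "frucht (f x) y" "common (f x) y" using t(1) by (auto simp: tri_def)
    then obtain z where "z < 12" "y = f z" using vertex bij by (metis bij_betw_def imageE lessThan_iff)
    then show ?thesis
      using y t(2) adj_iff[of x z] common_iff[of x z] by (auto simp: tri_def)
  qed
  have tri_f: "tri (f x)" if t: "tri x" for x
  proof -
    obtain y where "frucht x y" "common x y" using t by (auto simp: tri_def)
    then show ?thesis using f_adj common_iff[of x y] vertex unfolding tri_def by blast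
  qed
  have lt: "f x < 12" if "x < 12" for x using bij that by (auto simp: bij_betw_def)
  have nt: "f x = 2 \<or> f x = 9 \<or> f x = 10" if "x = 2 \<or> x = 9 \<or> x = 10" for x
    using that not_tri tri_if[of x] lt[of x] by (intro tri) auto
  have adj: "frucht (f 10) (f 2)" "frucht (f 10) (f 9)"
    by (rule f_adj, simp add: N)+
  have f10: "f 10 = 10"
    using nt[of 2] nt[of 9] nt[of 10] adj inj[of 2 9] by (auto simp: N)
  \<comment> \<open>11 is the only neighbour of 10 that lies in a triangle.\<close>
  have "frucht 11 0" "frucht 11 1" "frucht 0 1" by (simp_all add: N)
  then have "tri 11" unfolding tri_def common_def by blast
  then have "tri (f 11)" by (rule tri_f)
  moreover have "frucht 10 (f 11)" using f_adj[of 10 11] f10 by (simp add: N)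
  ultimately have f11: "f 11 = 11" using not_tri by (auto simp: N)
  \<comment> \<open>This leaves 0 or 1 for \<open>f 1\<close>; 0 has no neighbour among 2, 9, 10,
    where \<open>f 2\<close> must lie.\<close>
  have "frucht 11 (f 1)" using f_adj[of 11 1] f11 by (simp add: N)
  moreover have "f 1 \<noteq> 10" using inj[of 1 10] f10 by simp
  moreover have "frucht (f 1) (f 2)" by (rule f_adj) (simp only: N simp_thms)
  moreover have "f 2 = 2 \<or> f 2 = 9 \<or> f 2 = 10" by (rule nt) simp
  ultimately have f1: "f 1 = 1" by (auto simp: N)
  have f0: "f 0 = 0" by (rule fixed_last_neighbour[of 11]) (use f10 f11 f1 in \<open>auto simp only: N\<close>)
  have f2: "f 2 = 2" by (rule fixed_last_neighbour[of 1]) (use f0 f11 f1 in \<open>auto simp only: N\<close>)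
  have f9: "f 9 = 9" by (rule fixed_last_neighbour[of 10]) (use f2 f11 f10 in \<open>auto simp only: N\<close>)
  have f7: "f 7 = 7" by (rule fixed_last_neighbour[of 0]) (use f0 f11 f1 in \<open>auto simp only: N\<close>)
  have f3: "f 3 = 3" by (rule fixed_last_neighbour[of 2]) (use f1 f2 f10 in \<open>auto simp only: N\<close>)
  \<comment> \<open>4 is the only common neighbour of 3 and 9.\<close>
  have "frucht 9 (f 4)" "frucht 3 (f 4)" using f_adj[of 9 4] f_adj[of 3 4] f9 f3 by (simp_all add: N)
  then have f4: "f 4 = 4" unfolding N by auto
  have f8: "f 8 = 8" by (rule fixed_last_neighbour[of 9]) (use f4 f9 f10 in \<open>auto simp only: N\<close>)
  have f6: "f 6 = 6" by (rule fixed_last_neighbour[of 7]) (use f0 f7 f8 in \<open>auto simp only: N\<close>)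
  have f5: "f 5 = 5" by (rule fixed_last_neighbour[of 3]) (use f2 f3 f4 in \<open>auto simp only: N\<close>)
  show ?thesis
    using x by (rule frucht_vertex_cases) (use f0 f1 f2 f3 f4 f5 f6 f7 f8 f9 f10 f11 in simp_all)
qed

section \<open>Existence, unbounded order and the infinite family\<close>

lemma ex_asymmetric_regular_graph:
  assumes k: "k \<ge> 3"
  shows "\<exists>G :: nat hypergraph. asymmetric_regular 2 k G \<and> card (verts G) > 0"
proof -
  have quartic: "asymmetric_regular 2 4 (nat_graph n (quartic n))" if n: "n \<ge> 10" for n
  proof (rule asymmetric_regular_nat_graph)
    show "quartic n x y \<Longrightarrow> x < n" for x y using n by (auto simp: quartic_def quartic_step_def)
    show "quartic n x y \<Longrightarrow> quartic n y x" for x y by (auto simp: quartic_def)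
    show "\<not> quartic n x x" for x using n by (auto simp: quartic_def quartic_step_def)
  qed (use n quartic_degree quartic_rigid in auto)
  have cubic: "asymmetric_regular 2 3 (nat_graph 12 frucht)"
  proof (rule asymmetric_regular_nat_graph)
    show "frucht x y \<Longrightarrow> frucht y x" for x y by (simp add: frucht_def insert_commute)
    show "\<not> frucht x x" for x by (auto simp: frucht_def doubleton_eq_iff)
  qed (use frucht_bound frucht_degree frucht_rigid in auto)
  have card: "card (verts (nat_graph n A)) = n" for n A by (simp add: nat_graph_def)
  consider "k = 3" | "k = 4" | "k \<ge> 5" using k by linarith
  then show ?thesis
  proof cases
    case 1
    then show ?thesis using cubic card by (metis zero_less_numeral)
  next
    case 2
    then show ?thesis using quartic[of 10] card by (metis order_refl zero_less_numeral)
  next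
    case 3
    \<comment> \<open>n = k + 5 solves n - 1 - 4 = k, and k >= 5 yields n >= 10.\<close>
    let ?G = "nat_graph (k + 5) (quartic (k + 5))"
    have "asymmetric_regular 2 k (complement ?G)"
      using asymmetric_regular_complement[OF quartic[of "k + 5"]] 3 by (simp add: card)
    moreover have "card (verts (complement ?G)) > 0" by (simp add: complement_def nat_graph_def)
    ultimately show ?thesis by blast
  qed
qed

text \<open>Each passage to the flag graph multiplies the order by k, so it at least doubles.
  Relabelling by natural numbers keeps the vertex type fixed through the induction.\<close>

lemma ex_large_asymmetric_regular_graph:
  assumes k: "k \<ge> 3"
  shows "\<exists>G :: nat hypergraph. asymmetric_regular 2 k G \<and> card (verts G) > m"
proof (induction m)
  case 0
  show ?case using ex_asymmetric_regular_graph[OF k] .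
next
  case (Suc m)
  then obtain G :: "nat hypergraph" where G: "asymmetric_regular 2 k G" "card (verts G) > m" by auto
  note flag = asymmetric_regular_flag_graph[OF G(1) k]
  obtain H :: "nat hypergraph" where H: "asymmetric_regular 2 k H"
    "card (verts H) = card (verts (flag_graph G))"
    using asymmetric_regular_nat_copy[OF flag(1)] .
  have "2 * card (verts G) \<le> card (verts H)" using H(2) flag(2) k by simp
  then have "card (verts H) > Suc m" using G(2) by linarith
  then show ?case using H(1) by blast
qed

lemma isomorphic_card: "isomorphic G H \<Longrightarrow> card (verts G) = card (verts H)"
  by (auto simp: isomorphic_def dest: bij_betw_same_card)

theorem theorem3:
  fixes k :: nat
  assumes "k \<ge> 3"
  shows "\<exists>\<G> :: nat hypergraph set. infinite \<G> \<and>
           (\<forall>G\<in>\<G>. k_graph k G \<and> regular 2 G \<and> asymmetric G) \<and>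
           pairwise (\<lambda>G H. \<not> isomorphic G H) \<G>"
proof -
  \<comment> \<open>Infinitely many orders suffice: choosing one hypergraph for each order in S
    gives pairwise non-isomorphic ones.\<close>
  define S where "S = {card (verts G) |G :: nat hypergraph. asymmetric_regular k 2 G}"
  have "\<exists>s\<in>S. m < s" for m
  proof -
    obtain G :: "nat hypergraph" where G: "asymmetric_regular 2 k G" "card (verts G) > 2 * m"
      using ex_large_asymmetric_regular_graph[OF assms] by blast
    obtain H :: "nat hypergraph" where H: "asymmetric_regular k 2 H"
      "card (verts H) = card (verts (dual G))"
      using asymmetric_regular_nat_copy[OF asymmetric_regular_dual[OF G(1)]] assms by auto
    have "m < card (verts H)" using card_verts_le_card_dual[OF G(1)] G(2) H(2) assms by simp
    then show ?thesis using H(1) unfolding S_def by blast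
  qed
  then have S: "infinite S" by (meson finite_nat_set_iff_bounded less_asym)
  have "\<forall>s\<in>S. \<exists>G :: nat hypergraph. asymmetric_regular k 2 G \<and> card (verts G) = s"
    by (auto simp: S_def)
  then obtain g :: "nat \<Rightarrow> nat hypergraph" where
    g: "\<And>s. s \<in> S \<Longrightarrow> asymmetric_regular k 2 (g s) \<and> card (verts (g s)) = s"
    by metis
  have "inj_on g S" using g by (metis inj_onI)
  then have "infinite (g ` S)" using S by (simp add: finite_image_iff)
  moreover have "pairwise (\<lambda>G H. \<not> isomorphic G H) (g ` S)"
    using g by (auto simp: pairwise_def dest!: isomorphic_card)
  ultimately show ?thesis
    using g by (intro exI[of _ "g ` S"]) (auto simp: asymmetric_regular_def)
qed

end
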